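(* Let $n$ be a positive integer and let $F = F(-n,b;\,c;\,z)$ with $b,c\in\mathbb{R}$. Suppose that $c<0$, $b>0$ and $c-b>1-n$. Then: (i) $1-n<c-b<0$, $0<b<n-1$ and $1-n<c<0$. (ii) If $-k<c<-k+1$ with $k\in\{1,\dots,n-1\}$ and $-j<c-b<-j+1$ with $j\in\{1,\dots,n-1\}$, then $F(-n,b;\,c;\,z)$ has $(j-k)\ge 0$ real zeros in $(0,1)$. For the remaining $(n-j+k)$ zeros of $F$: (a) $(n-j+k)$ are non-real if $(n-j)$ and $k$ are even; (b) $(n-j+k-1)$ are non-real and one real zero lies in $(1,\infty)$ if $(n-j)$ is odd and $k$ is even; (c) $(n-j+k-1)$ are non-real and one zero is real and negative if $(n-j)$ is even and $k$ is odd; (d) $(n-j+k-2)$ are non-real, with one real negative zero and one real zero in $(1,\infty)$, if $(n-j)$ is odd and $k$ is odd.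
   Context: For a positive integer $n$ and real $b,c$ with $c\notin\{0,-1,\dots,-n+1\}$, $F(-n,b;\,c;\,z)$ denotes the hypergeometric polynomial in the complex variable $z$ $$F(-n,b;\,c;\,z) = 1+\sum_{k=1}^{n} \frac{(-n)_k (b)_k}{(c)_k}\frac{z^k}{k!},\qquad (\alpha)_k = \alpha(\alpha+1)\cdots(\alpha+k-1).$$ *)

theory Defs
  imports "HOL-Computational_Algebra.Computational_Algebra" Complex_Main
begin

text \<open>
  The hypergeometric polynomial \<open>F(-n, b; c; z)\<close> as a complex polynomial in \<open>z\<close>. It is meaningful
  only if \<open>c\<close> is none of \<open>0, -1, \<dots>, -n + 1\<close>, i.e. if the denominators do not vanish.
\<close>
definition hypergeo_poly :: "nat \<Rightarrow> real \<Rightarrow> real \<Rightarrow> complex poly" where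
  "hypergeo_poly n b c =
     1 + (\<Sum>k=1..n. monom (complex_of_real
           (pochhammer (- real n) k * pochhammer b k / (pochhammer c k * fact k))) k)"

lemma poly_hypergeo_poly:
  "poly (hypergeo_poly n b c) z =
     1 + (\<Sum>k=1..n. complex_of_real (pochhammer (- real n) k * pochhammer b k / pochhammer c k)
                     * (z ^ k / fact k))"
  by (simp add: hypergeo_poly_def poly_sum poly_monom)

text \<open>
  Zeros are counted with multiplicity. For the zero polynomial the multiset of roots is empty.
\<close>
definition num_zeros :: "complex poly \<Rightarrow> complex set \<Rightarrow> nat" where
  "num_zeros p S = size {# z \<in># proots p. z \<in> S #}"

end

theory Submission
  imports Defs
begin

text \<open>
  The proof compares the zeros of \<open>F = F(-n, b; c; \<cdot>)\<close> with those of \<open>F'\<close>, which is a nonzero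
  multiple of \<open>F(-(n-1), b+1; c+1; \<cdot>)\<close> and therefore a polynomial of the same family.
  The hypergeometric equation
  \<open>x (1 - x) F'' + (c - (b + 1 - n) x) F' + n b F = 0\<close>
  makes the comparison exact. Since \<open>n b > 0\<close>, at a critical point \<open>F''\<close> and \<open>F\<close> have opposite
  signs inside \<open>(0,1)\<close> and equal signs outside \<open>[0,1]\<close>. Now consider \<open>F F'\<close>, whose
  derivative is \<open>F'\<^sup>2 + F F''\<close>. It crosses zero upwards at each zero of \<open>F\<close>; at each zero of \<open>F'\<close>
  it crosses downwards inside \<open>(0,1)\<close> and upwards outside. The number of upward minus the number
  of downward crossings on an interval depends only on the signs of \<open>F F'\<close> at its ends. Writing
  \<open>N\<close> and \<open>N'\<close> for the numbers of zeros of \<open>F\<close> and \<open>F'\<close> on the interval in question, one so knows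
  \<open>N - N'\<close> on \<open>(0,1)\<close> and \<open>N + N'\<close> on \<open>(-\<infinity>,0)\<close> and \<open>(1,\<infinity>)\<close>.

  The signs at the ends are explicit: the equation and the formula for \<open>F'\<close> give \<open>-sgn c\<close>
  at \<open>0\<close> and \<open>-sgn (c - b + n - 1)\<close> at \<open>1\<close>, and \<open>F F'\<close> has odd degree and positive leading
  coefficient. Passing from \<open>F\<close> to \<open>F'\<close> keeps \<open>b > 0\<close> and \<open>c - b\<close>, drops the first term of
  \<open>c, c+1, \<dots>, c+n-1\<close> and the last term of \<open>c-b, \<dots>, c-b+n-1\<close>. With \<open>k\<close> and \<open>j\<close> the numbers of
  negative terms of these two progressions, the relations for \<open>N\<close> and \<open>N'\<close> are solved by
  \<open>j - k\<close> zeros in \<open>(0,1)\<close>, \<open>k mod 2\<close> zeros in \<open>(-\<infinity>,0)\<close> and \<open>(n - j) mod 2\<close> zeros in \<open>(1,\<infinity>)\<close>: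
  this is \<open>hyp_real_zero_counts\<close>, an induction on \<open>n\<close> valid for every \<open>b > 0\<close> for which neither
  progression contains \<open>0\<close>. It is essential to allow both signs of \<open>c\<close> and of \<open>c - b + n - 1\<close>
  there, because differentiation leaves the parameter region of the final theorem.

  Zeros of \<open>F\<close> other than \<open>0\<close> and \<open>1\<close> are simple, by the same recursion, and \<open>0\<close> and \<open>1\<close> are not
  zeros; hence counting real zeros with multiplicity is counting points, and the remaining
  zeros among the \<open>n\<close> complex ones are non-real.
\<close>

section \<open>Hypergeometric polynomials: derivative, differential equation, simple zeros\<close>

text \<open>
  The coefficient field is left open: real coefficients are needed for the sign arguments, complex
  ones for the multiplicity of the zeros of \<^const>\<open>hypergeo_poly\<close>. Including the term \<open>k = 0\<close> in the
  sum makes the coefficient formula below uniform.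
\<close>
definition hyp :: "nat \<Rightarrow> 'a::field_char_0 \<Rightarrow> 'a \<Rightarrow> 'a poly" where
  "hyp n b c = (\<Sum>k\<le>n. monom (pochhammer (- of_nat n) k * pochhammer b k /
     (pochhammer c k * fact k)) k)"

lemma coeff_hyp:
  "coeff (hyp n b c) k =
     pochhammer (- of_nat n) k * pochhammer b k / (pochhammer c k * fact k)"
proof (cases "k \<le> n")
  case True
  then show ?thesis by (simp add: hyp_def coeff_sum)
next
  case False
  then have "pochhammer (- of_nat n :: 'a) k = 0"
    by (intro pochhammer_of_nat_eq_0_lemma) simp
  with False show ?thesis by (simp add: hyp_def coeff_sum)
qed

lemma hyp_0: "hyp 0 b c = 1"
  by (simp add: hyp_def)

lemma poly_hyp_0: "poly (hyp n b c) 0 = 1"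
  by (simp add: poly_0_coeff_0 coeff_hyp)

lemma hyp_nonzero: "hyp n b c \<noteq> 0"
  using poly_hyp_0[of n b c] by auto

lemma pderiv_hyp:
  "pderiv (hyp (Suc n) b c) = smult (- of_nat (Suc n) * b / c) (hyp n (b + 1) (c + 1))"
proof (rule poly_eqI)
  fix m
  have "fact (Suc m) = (of_nat (Suc m) * fact m :: 'a)" by (simp add: fact_Suc)
  moreover have "pochhammer (- of_nat (Suc n) :: 'a) (Suc m) =
      - of_nat (Suc n) * pochhammer (- of_nat n) m"
    by (subst pochhammer_rec) simp
  ultimately show "coeff (pderiv (hyp (Suc n) b c)) m =
    coeff (smult (- of_nat (Suc n) * b / c) (hyp n (b + 1) (c + 1))) m"
    by (simp add: coeff_pderiv coeff_hyp pochhammer_rec[of b] pochhammer_rec[of c] field_simps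
        del: of_nat_Suc)
qed

lemma coeff_hyp_recurrence:
  assumes "\<forall>i<n. c + of_nat i \<noteq> 0"
  shows "of_nat (Suc m) * (c + of_nat m) * coeff (hyp n b c) (Suc m) =
    (of_nat m - of_nat n) * (b + of_nat m) * coeff (hyp n b c) m"
proof (cases "m < n")
  case True
  with assms have "c + of_nat m \<noteq> 0" by blast
  moreover have "fact (Suc m) = (of_nat (Suc m) * fact m :: 'a)" by (simp add: fact_Suc)
  ultimately show ?thesis
    by (simp add: coeff_hyp pochhammer_Suc divide_simps del: of_nat_Suc)
next
  case False
  then have "pochhammer (- of_nat n :: 'a) (Suc m) = 0"
    by (intro pochhammer_of_nat_eq_0_lemma) simp
  moreover have "m = n \<or> coeff (hyp n b c) m = 0"
    using False pochhammer_of_nat_eq_0_lemma[of n m, where 'a='a] 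
    by (auto simp: coeff_hyp)
  ultimately show ?thesis by (auto simp: coeff_hyp)
qed

text \<open>The hypergeometric differential equation is the coefficient recurrence above, summed.\<close>
lemma hyp_ode:
  assumes "\<forall>i<n. c + of_nat i \<noteq> 0"
  shows "x * (1 - x) * poly (pderiv (pderiv (hyp n b c))) x
     + (c - (b + 1 - of_nat n) * x) * poly (pderiv (hyp n b c)) x
     + of_nat n * b * poly (hyp n b c) x = 0"
proof -
  let ?F = "hyp n b c"
  \<comment> \<open>The left-hand side as a polynomial, in monomials so that coefficients can be compared.\<close>
  let ?q = "monom 1 1 * pderiv (pderiv ?F) - monom 1 2 * pderiv (pderiv ?F)
     + smult c (pderiv ?F) - smult (b + 1 - of_nat n) (monom 1 1 * pderiv ?F)
     + smult (of_nat n * b) ?F"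
  have "?q = 0"
  proof (rule poly_eqI)
    fix m
    consider "m = 0" | "m = 1" | l where "m = Suc (Suc l)"
      by (metis One_nat_def not0_implies_Suc)
    then show "coeff ?q m = coeff 0 m"
      using coeff_hyp_recurrence[OF assms, of m b]
      by cases (simp_all add: coeff_monom_mult coeff_pderiv algebra_simps numeral_2_eq_2)
  qed
  then have "poly ?q x = 0" by simp
  then show ?thesis
    by (simp add: poly_monom algebra_simps power2_eq_square)
qed

lemma shift_nonzero:
  fixes c :: "'a::field_char_0"
  assumes "\<forall>i<Suc n. c + of_nat i \<noteq> 0"
  shows "\<forall>i<n. c + 1 + of_nat i \<noteq> 0"
proof (intro allI impI)
  fix i assume "i < n"
  with assms have "c + of_nat (Suc i) \<noteq> 0" by blast
  then show "c + 1 + of_nat i \<noteq> 0" by (simp add: add.assoc)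
qed

text \<open>
  At a common zero \<open>x\<close> of \<open>F\<close> and \<open>F'\<close> away from the singular points \<open>0\<close> and \<open>1\<close> the equation gives
  \<open>F'' x = 0\<close> too. So \<open>x\<close> is also a common zero of \<open>F'\<close> and \<open>F''\<close>, that is, of the polynomial of
  degree \<open>n - 1\<close> in the family and its derivative, and this descends to the constant \<open>1\<close>.
\<close>
lemma hyp_simple_zeros:
  assumes "\<forall>i<n. b + of_nat i \<noteq> 0" and "\<forall>i<n. c + of_nat i \<noteq> 0"
    and "x \<noteq> 0" "x \<noteq> 1" and "poly (hyp n b c) x = 0"
  shows "poly (pderiv (hyp n b c)) x \<noteq> 0"
  using assms
proof (induction n arbitrary: b c)
  case 0
  then show ?case by (simp add: hyp_0)
next
  case (Suc n)
  have bc: "b \<noteq> 0" "c \<noteq> 0" using Suc.prems(1,2) by fastforce+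
  show ?case
  proof
    assume d: "poly (pderiv (hyp (Suc n) b c)) x = 0"
    with hyp_ode[OF Suc.prems(2), of x b] Suc.prems
    have "poly (pderiv (pderiv (hyp (Suc n) b c))) x = 0" by simp
    then have "poly (pderiv (hyp n (b + 1) (c + 1))) x = 0"
      using bc unfolding pderiv_hyp pderiv_smult poly_smult
      by (simp del: of_nat_Suc)
    moreover from d have "poly (hyp n (b + 1) (c + 1)) x = 0"
      using bc by (simp add: pderiv_hyp del: of_nat_Suc)
    ultimately show False
      using Suc.IH[of "b + 1" "c + 1"] shift_nonzero[OF Suc.prems(1)] 
        shift_nonzero[OF Suc.prems(2)] Suc.prems(3,4) by blast
  qed
qed

text \<open>
  At \<open>x = 1\<close> the equation has no second-order term and turns the formula for \<open>F'\<close> into a first-order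
  recurrence for the values \<open>F 1\<close>, whose solution is the Chu-Vandermonde product
  \<open>(c - b)\<^sub>n / (c)\<^sub>n\<close>; none of its factors vanishes.
\<close>
lemma poly_hyp_1_nonzero:
  assumes "\<forall>i<n. c + of_nat i \<noteq> 0" and "\<forall>i<n. c - b + of_nat i \<noteq> 0"
  shows "poly (hyp n b c) 1 \<noteq> 0"
  using assms
proof (induction n arbitrary: b c)
  case 0
  then show ?case by (simp add: hyp_0)
next
  case (Suc n)
  have IH: "poly (hyp n (b + 1) (c + 1)) 1 \<noteq> 0"
    using Suc.IH[of "c + 1" "b + 1"] shift_nonzero[OF Suc.prems(1)] Suc.prems(2) by simp
  have bc: "c \<noteq> 0" "c - b + of_nat n \<noteq> 0" using Suc.prems(1,2) by fastforce+
  show ?case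
  proof (cases "b = 0")
    case True
    then have "hyp (Suc n) b c = 1"
      by (intro poly_eqI) (simp add: coeff_hyp pochhammer_0_left)
    then show ?thesis by simp
  next
    case False
    then have "poly (pderiv (hyp (Suc n) b c)) 1 \<noteq> 0"
      using IH bc by (simp add: pderiv_hyp del: of_nat_Suc)
    moreover have "(c - b + of_nat n) * poly (pderiv (hyp (Suc n) b c)) 1
        + of_nat (Suc n) * b * poly (hyp (Suc n) b c) 1 = 0"
      using hyp_ode[OF Suc.prems(1), of 1 b] by (simp add: algebra_simps)
    ultimately show ?thesis using bc(2) by auto
  qed
qed

section \<open>Counting zeros by sign changes\<close>

lemma sgn_poly_eq:
  fixes g :: "real poly"
  assumes "u \<le> v" and "\<And>x. u \<le> x \<Longrightarrow> x \<le> v \<Longrightarrow> poly g x \<noteq> 0"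
  shows "sgn (poly g u) = sgn (poly g v)"
proof (rule ccontr)
  assume *: "sgn (poly g u) \<noteq> sgn (poly g v)"
  then have "u < v" using assms(1) by (cases "u = v") auto
  moreover have "poly g u * poly g v < 0"
    using * assms(2)[of u] assms(2)[of v] assms(1)
    by (auto simp: sgn_if mult_less_0_iff split: if_splits)
  ultimately show False using poly_IVT[of u v g] assms(2) by force
qed

lemma sgn_near_simple_root:
  fixes g :: "real poly"
  assumes "poly g x = 0" "poly (pderiv g) x \<noteq> 0"
  obtains d where "d > 0"
    "\<And>h. 0 < h \<Longrightarrow> h < d \<Longrightarrow> sgn (poly g (x + h)) = sgn (poly (pderiv g) x)"
    "\<And>h. 0 < h \<Longrightarrow> h < d \<Longrightarrow> sgn (poly g (x - h)) = - sgn (poly (pderiv g) x)"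
proof (cases "poly (pderiv g) x > 0")
  case True
  obtain d1 d2 where "d1 > 0" "d2 > 0" "\<forall>h>0. h < d1 \<longrightarrow> poly g x < poly g (x + h)"
      "\<forall>h>0. h < d2 \<longrightarrow> poly g (x - h) < poly g x"
    using DERIV_pos_inc_right[OF poly_DERIV True] DERIV_pos_inc_left[OF poly_DERIV True] by blast
  then show ?thesis
    using that[of "min d1 d2"] True assms(1) by simp
next
  case False
  then have neg: "poly (pderiv g) x < 0" using assms(2) by simp
  obtain d1 d2 where "d1 > 0" "d2 > 0" "\<forall>h>0. h < d1 \<longrightarrow> poly g x > poly g (x + h)"
      "\<forall>h>0. h < d2 \<longrightarrow> poly g (x - h) > poly g x"
    using DERIV_neg_dec_right[OF poly_DERIV neg] DERIV_neg_dec_left[OF poly_DERIV neg] by blast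
  then show ?thesis
    using that[of "min d1 d2"] neg assms(1) by simp
qed

text \<open>
  Each simple zero is a sign change whose direction is the sign of the derivative, so the directions
  telescope. The induction removes the leftmost zero by moving the left end just past it.
\<close>
lemma signed_root_count:
  fixes g :: "real poly"
  assumes "a < b" "poly g a \<noteq> 0" "poly g b \<noteq> 0"
    and "\<And>x. a < x \<Longrightarrow> x < b \<Longrightarrow> poly g x = 0 \<Longrightarrow> poly (pderiv g) x \<noteq> 0"
  shows "2 * (\<Sum>x | a < x \<and> x < b \<and> poly g x = 0. sgn (poly (pderiv g) x))
    = sgn (poly g b) - sgn (poly g a)"
  using assms
proof (induction "card {x. a < x \<and> x < b \<and> poly g x = 0}" arbitrary: a rule: less_induct)
  case less
  let ?Z = "\<lambda>a. {x. a < x \<and> x < b \<and> poly g x = 0}"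
  have fin: "finite (?Z a)" for a
    by (rule finite_subset[OF _ poly_roots_finite[of g]]) (use less.prems(2) in auto)
  show ?case
  proof (cases "?Z a = {}")
    case True
    then have "sgn (poly g a) = sgn (poly g b)"
      using less.prems by (intro sgn_poly_eq) (auto simp: le_less)
    with True show ?thesis by (simp only:) simp
  next
    case False
    define x where "x = Min (?Z a)"
    have x: "a < x" "x < b" "poly g x = 0" and x_le: "\<And>y. y \<in> ?Z a \<Longrightarrow> x \<le> y"
      using Min_in[OF fin False] Min_le[OF fin, of _ a] by (auto simp: x_def)
    obtain d where d: "d > 0"
      "\<And>h. 0 < h \<Longrightarrow> h < d \<Longrightarrow> sgn (poly g (x + h)) = sgn (poly (pderiv g) x)"
      "\<And>h. 0 < h \<Longrightarrow> h < d \<Longrightarrow> sgn (poly g (x - h)) = - sgn (poly (pderiv g) x)"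
      using sgn_near_simple_root[OF x(3) less.prems(4)[OF x]] by blast
    \<comment> \<open>Halving the minimum keeps \<open>x - h\<close> and \<open>x + h\<close> strictly inside both \<open>(a, b)\<close> and the
        neighbourhood of \<open>x\<close> on which the sign is known.\<close>
    define h where "h = min d (min (x - a) (b - x)) / 2"
    have h: "0 < h" "h < d" "a < x - h" "x + h < b"
      using d(1) x by (auto simp: h_def min_def field_simps)
    have nz: "poly g y \<noteq> 0" if "x < y" "y \<le> x + h" for y
      using d(2)[of "y - x"] that h less.prems(4)[OF x] by (auto simp: sgn_zero_iff)
    have Z: "?Z a = insert x (?Z (x + h))"
    proof (intro set_eqI iffI)
      fix y assume y: "y \<in> ?Z a"
      with nz[of y] x_le[OF y] show "y \<in> insert x (?Z (x + h))" by force
    qed (use x h in auto)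
    have "sgn (poly g a) = sgn (poly g (x - h))"
    proof (rule sgn_poly_eq)
      show "poly g y \<noteq> 0" if "a \<le> y" "y \<le> x - h" for y
        using x_le[of y] that h x less.prems(2) by (cases "y = a") auto
    qed (use h in simp)
    also have "\<dots> = - sgn (poly (pderiv g) x)" using d(3) h by blast
    finally have left: "sgn (poly g a) = - sgn (poly (pderiv g) x)" .
    have right: "sgn (poly g (x + h)) = sgn (poly (pderiv g) x)" using d(2) h by blast
    have "card (?Z (x + h)) < card (?Z a)"
      unfolding Z using fin[of "x + h"] h by (subst card_insert_disjoint) auto
    moreover have "poly (pderiv g) y \<noteq> 0" if "x + h < y" "y < b" "poly g y = 0" for y
      using that x h by (intro less.prems(4)) auto
    ultimately have "2 * (\<Sum>y\<in>?Z (x + h). sgn (poly (pderiv g) y))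
        = sgn (poly g b) - sgn (poly g (x + h))"
      using h nz[of "x + h"] less.prems(3) by (intro less.hyps) auto
    moreover have "(\<Sum>y\<in>?Z a. sgn (poly (pderiv g) y)) =
        sgn (poly (pderiv g) x) + (\<Sum>y\<in>?Z (x + h). sgn (poly (pderiv g) y))"
      unfolding Z using fin[of "x + h"] h by (subst sum.insert) auto
    ultimately show ?thesis using left right by simp
  qed
qed

text \<open>
  The signed count applied to \<open>f f'\<close>: a zero of \<open>f\<close> counts \<open>+1\<close> because there the derivative is
  \<open>f'\<^sup>2\<close>, and a zero of \<open>f'\<close> counts \<open>s\<close> because there it is \<open>f f''\<close>. For \<open>s = -1\<close> this is a Rolle
  theorem with equality, for \<open>s = 1\<close> it says that zeros and critical points together are at most one.
\<close>
lemma zeros_and_critical_points_count: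
  fixes f :: "real poly" and s :: real
  defines "f' \<equiv> pderiv f"
  assumes "a < b" and ends: "poly f a * poly f' a \<noteq> 0" "poly f b * poly f' b \<noteq> 0"
    and "s \<noteq> 0"
    and simple: "\<And>x. a < x \<Longrightarrow> x < b \<Longrightarrow> poly f x = 0 \<Longrightarrow> poly f' x \<noteq> 0"
    and crit: "\<And>x. a < x \<Longrightarrow> x < b \<Longrightarrow> poly f' x = 0 \<Longrightarrow>
      sgn (poly f x * poly (pderiv f') x) = s"
  shows "2 * (real (card {x. a < x \<and> x < b \<and> poly f x = 0})
      + s * real (card {x. a < x \<and> x < b \<and> poly f' x = 0}))
    = sgn (poly f b * poly f' b) - sgn (poly f a * poly f' a)"
proof -
  define g where "g = f * f'"
  have g': "poly (pderiv g) x = (poly f' x)\<^sup>2 + poly f x * poly (pderiv f') x" for x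
    by (simp add: g_def pderiv_mult f'_def power2_eq_square algebra_simps)
  let ?Z = "\<lambda>p. {x. a < x \<and> x < b \<and> poly p x = 0}"
  have "f \<noteq> 0" "f' \<noteq> 0" using ends by auto
  have fin: "finite (?Z p)" if "p \<noteq> 0" for p :: "real poly"
    by (rule finite_subset[OF _ poly_roots_finite[OF that]]) auto
  have up: "sgn (poly (pderiv g) x) = 1" if "x \<in> ?Z f" for x
    using that simple[of x] by (simp add: g' sgn_if)
  have down: "sgn (poly (pderiv g) x) = s" if "x \<in> ?Z f'" for x
    using that crit[of x] by (simp add: g')
  have Z: "?Z g = ?Z f \<union> ?Z f'" by (auto simp: g_def)
  have "2 * (\<Sum>x\<in>?Z g. sgn (poly (pderiv g) x)) = sgn (poly g b) - sgn (poly g a)"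
  proof (rule signed_root_count)
    fix x assume x: "a < x" "x < b" "poly g x = 0"
    then have "x \<in> ?Z f \<union> ?Z f'" by (auto simp: g_def)
    then have "sgn (poly (pderiv g) x) \<noteq> 0" using up[of x] down[of x] \<open>s \<noteq> 0\<close> by auto
    then show "poly (pderiv g) x \<noteq> 0" by auto
  qed (use assms in \<open>auto simp: g_def\<close>)
  also have "(\<Sum>x\<in>?Z g. sgn (poly (pderiv g) x)) =
      (\<Sum>x\<in>?Z f. sgn (poly (pderiv g) x)) + (\<Sum>x\<in>?Z f'. sgn (poly (pderiv g) x))"
    unfolding Z using fin \<open>f \<noteq> 0\<close> \<open>f' \<noteq> 0\<close> simple by (intro sum.union_disjoint) auto
  also have "\<dots> = real (card (?Z f)) + s * real (card (?Z f'))"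
    using up down by simp
  finally show ?thesis by (simp add: g_def)
qed

text \<open>
  Near \<open>\<plusminus>\<infinity>\<close> the sign of \<open>f f'\<close> is that of its leading term, a positive multiple of an odd power.
\<close>
lemma eventually_poly_mult_pderiv_pos:
  fixes f :: "real poly"
  assumes "degree f > 0"
  shows "\<exists>R. \<forall>x\<ge>R. poly f x * poly (pderiv f) x > 0"
proof -
  have "lead_coeff (f * pderiv f) = real (degree f) * (lead_coeff f)\<^sup>2"
    using assms by (simp add: lead_coeff_mult coeff_pderiv degree_pderiv power2_eq_square
      coeff_pderiv)
  also have "\<dots> > 0"
    using assms leading_coeff_neq_0[of f] by (intro mult_pos_pos) auto
  finally have "lead_coeff (f * pderiv f) > 0" .
  from poly_pinfty_gt_lc[OF this] this show ?thesis
    by (metis less_le_trans poly_mult)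
qed

lemma eventually_poly_mult_pderiv_neg:
  fixes f :: "real poly"
  assumes "degree f > 0"
  shows "\<exists>R. \<forall>x\<le>R. poly f x * poly (pderiv f) x < 0"
proof -
  let ?h = "pcompose f [:0, -1:]"
  obtain R where R: "\<forall>x\<ge>R. poly ?h x * poly (pderiv ?h) x > 0"
    using eventually_poly_mult_pderiv_pos[of ?h] assms
    by (auto simp: degree_pcompose)
  have "poly f x * poly (pderiv f) x < 0" if "x \<le> - R" for x
    using R[rule_format, of "- x"] that
    by (simp add: poly_pcompose pderiv_pcompose pderiv_pCons)
  then show ?thesis by blast
qed

section \<open>One differentiation step\<close>

lemma degree_hyp:
  fixes b c :: real
  assumes "b > 0" and "\<forall>i<n. c + real i \<noteq> 0"
  shows "degree (hyp n b c) = n"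
proof (rule antisym)
  show "degree (hyp n b c) \<le> n"
    by (rule degree_le) (auto simp: coeff_hyp pochhammer_of_nat_eq_0_iff)
  have "coeff (hyp n b c) n \<noteq> 0"
  proof -
    have "c = - real i \<longleftrightarrow> c + real i = 0" for i by linarith
    then show ?thesis
      using assms pochhammer_pos[of b n]
      by (auto simp: coeff_hyp pochhammer_of_nat_eq_0_iff pochhammer_eq_0_iff)
  qed
  then show "n \<le> degree (hyp n b c)" by (rule le_degree)
qed

lemma sgn_opposite: "y * x < 0 \<Longrightarrow> sgn x = - sgn y" for x y :: real
  by (auto simp: mult_less_0_iff)

context
  fixes n :: nat and b c :: real and F F' :: "real poly"
  assumes b: "b > 0" and c: "\<forall>i<Suc n. c + real i \<noteq> 0"
    and cb: "\<forall>i<Suc n. c - b + real i \<noteq> 0"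
  defines "F \<equiv> hyp (Suc n) b c" and "F' \<equiv> pderiv F"
begin

lemma hyp_critical_point_iff: "poly F' x = 0 \<longleftrightarrow> poly (hyp n (b + 1) (c + 1)) x = 0"
  using b c by (auto simp: F'_def F_def pderiv_hyp simp del: of_nat_Suc)

lemma sgn_hyp_pderiv_at_0: "sgn (poly F 0 * poly F' 0) = - sgn c"
proof -
  have "poly F 0 * poly F' 0 = - (real (Suc n) * b / c)"
    by (simp add: F_def F'_def pderiv_hyp poly_hyp_0 del: of_nat_Suc)
  also have "sgn \<dots> = - sgn c"
    using b by (simp add: sgn_mult sgn_divide sgn_if[of c] del: of_nat_Suc)
  finally show ?thesis .
qed

text \<open>
  The equation at \<open>x = 1\<close> makes \<open>(c - b + n) F' 1\<close> a negative multiple of \<open>F 1\<close>. Here \<open>n\<close> is one less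
  than the degree.
\<close>
lemma sgn_hyp_pderiv_at_1: "sgn (poly F 1 * poly F' 1) = - sgn (c - b + real n)"
proof -
  have F1: "poly F 1 \<noteq> 0" unfolding F_def using c cb by (intro poly_hyp_1_nonzero) auto
  have ode: "(c - b + real n) * poly F' 1 = - (real (Suc n) * b * poly F 1)"
    using hyp_ode[of "Suc n" c 1 b] c by (simp add: F_def F'_def algebra_simps)
  have "(c - b + real n) * (poly F 1 * poly F' 1) = poly F 1 * ((c - b + real n) * poly F' 1)"
    by simp
  also have "\<dots> = - (real (Suc n) * b * (poly F 1)\<^sup>2)"
    unfolding ode by (simp add: power2_eq_square)
  also have "\<dots> < 0" using F1 b by simp
  finally show ?thesis by (rule sgn_opposite)
qed

lemma hyp_pderiv_nonzero_at_0: "poly F 0 * poly F' 0 \<noteq> 0"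
proof -
  have "c \<noteq> 0" using c by fastforce
  then show ?thesis using sgn_hyp_pderiv_at_0 by (metis neg_equal_0_iff_equal sgn_0_0)
qed

lemma hyp_pderiv_nonzero_at_1: "poly F 1 * poly F' 1 \<noteq> 0"
  using sgn_hyp_pderiv_at_1 cb by (metis lessI neg_equal_0_iff_equal sgn_0_0)

lemma hyp_Suc_simple_zeros: "x \<noteq> 0 \<Longrightarrow> x \<noteq> 1 \<Longrightarrow> poly F x = 0 \<Longrightarrow> poly F' x \<noteq> 0"
  unfolding F_def F'_def using b c by (intro hyp_simple_zeros) (auto simp: add_eq_0_iff)

text \<open>
  Without its first-order term the equation makes \<open>x (1 - x) F'' x\<close> a negative multiple of \<open>F x\<close>.
  The sign of \<open>x (1 - x)\<close> is what distinguishes the interval \<open>(0,1)\<close> from its outside.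
\<close>
lemma sgn_hyp_critical_point:
  assumes "x \<noteq> 0" "x \<noteq> 1" "poly F' x = 0"
  shows "sgn (poly F x * poly (pderiv F') x) = - sgn (x * (1 - x))"
proof -
  have "x * (1 - x) * poly (pderiv F') x = - (real (Suc n) * b * poly F x)"
    using hyp_ode[of "Suc n" c x b] c assms(3) by (simp add: F_def F'_def)
  then have "poly F x * (x * (1 - x) * poly (pderiv F') x) = poly F x * - (real (Suc n) * b * poly F x)"
    by (rule arg_cong)
  then have "x * (1 - x) * (poly F x * poly (pderiv F') x) = - (real (Suc n) * b * (poly F x)\<^sup>2)"
    by (simp add: mult_ac power2_eq_square)
  also have "\<dots> < 0"
  proof -
    have "poly F x \<noteq> 0" using hyp_Suc_simple_zeros[of x] assms by blast
    then show ?thesis using b by simp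
  qed
  finally show ?thesis by (rule sgn_opposite)
qed

lemma hyp_count_unit_interval:
  "2 * (real (card {x. 0 < x \<and> x < 1 \<and> poly F x = 0})
     - real (card {x. 0 < x \<and> x < 1 \<and> poly F' x = 0})) = sgn c - sgn (c - b + real n)"
proof -
  have "2 * (real (card {x. 0 < x \<and> x < 1 \<and> poly F x = 0})
     + (-1) * real (card {x. 0 < x \<and> x < 1 \<and> poly F' x = 0}))
     = sgn (poly F 1 * poly F' 1) - sgn (poly F 0 * poly F' 0)"
    unfolding F'_def
  proof (rule zeros_and_critical_points_count, unfold F'_def[symmetric])
    show "poly F 0 * poly F' 0 \<noteq> 0" by (rule hyp_pderiv_nonzero_at_0)
    show "poly F 1 * poly F' 1 \<noteq> 0" by (rule hyp_pderiv_nonzero_at_1)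
    show "poly F' x \<noteq> 0" if "0 < x" "x < 1" "poly F x = 0" for x
      using that hyp_Suc_simple_zeros by simp
    show "sgn (poly F x * poly (pderiv F') x) = - 1" if "0 < x" "x < 1" "poly F' x = 0" for x
      using that sgn_hyp_critical_point[of x] by simp
  qed auto
  then show ?thesis using sgn_hyp_pderiv_at_0 sgn_hyp_pderiv_at_1 by simp
qed

lemma hyp_count_outside_unit_interval:
  assumes "u < v" and "v \<le> 0 \<or> 1 \<le> u"
    and "poly F u * poly F' u \<noteq> 0" "poly F v * poly F' v \<noteq> 0"
  shows "2 * (real (card {x. u < x \<and> x < v \<and> poly F x = 0})
     + real (card {x. u < x \<and> x < v \<and> poly F' x = 0}))
     = sgn (poly F v * poly F' v) - sgn (poly F u * poly F' u)"
proof -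
  have "2 * (real (card {x. u < x \<and> x < v \<and> poly F x = 0})
     + 1 * real (card {x. u < x \<and> x < v \<and> poly F' x = 0}))
     = sgn (poly F v * poly F' v) - sgn (poly F u * poly F' u)"
    unfolding F'_def
  proof (rule zeros_and_critical_points_count, unfold F'_def[symmetric])
    show "poly F' x \<noteq> 0" if "u < x" "x < v" "poly F x = 0" for x
      using that hyp_Suc_simple_zeros assms(2) by auto
    show "sgn (poly F x * poly (pderiv F') x) = 1" if "u < x" "x < v" "poly F' x = 0" for x
      using that sgn_hyp_critical_point[of x] assms(2) by (auto simp: sgn_mult)
  qed (use assms in auto)
  then show ?thesis by simp
qed

lemma degree_F_pos: "degree F > 0"
  unfolding F_def using degree_hyp[OF b c] by simp

text \<open>
  On the two half-lines the far end is replaced by a point beyond all zeros of \<open>F\<close> and \<open>F'\<close>.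
\<close>
lemma hyp_count_negative:
  "2 * (real (card {x. x < 0 \<and> poly F x = 0}) + real (card {x. x < 0 \<and> poly F' x = 0}))
     = 1 - sgn c"
proof -
  obtain R0 where R0: "\<And>x. x \<le> R0 \<Longrightarrow> poly F x * poly F' x < 0"
    using eventually_poly_mult_pderiv_neg[OF degree_F_pos] by (auto simp: F'_def)
  define R where "R = min R0 (-1)"
  have R: "R < 0" "\<And>x. x \<le> R \<Longrightarrow> poly F x * poly F' x < 0" using R0 by (auto simp: R_def)
  have "R < x" if "poly F x = 0 \<or> poly F' x = 0" for x
    using R(2)[of x] that by force
  then have "{x. x < 0 \<and> poly F x = 0} = {x. R < x \<and> x < 0 \<and> poly F x = 0}"
    "{x. x < 0 \<and> poly F' x = 0} = {x. R < x \<and> x < 0 \<and> poly F' x = 0}" by auto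
  moreover have "poly F 0 * poly F' 0 \<noteq> 0" by (rule hyp_pderiv_nonzero_at_0)
  moreover have "poly F R * poly F' R < 0" using R(2) by simp
  then have "poly F R * poly F' R \<noteq> 0" "sgn (poly F R * poly F' R) = -1" by auto
  ultimately show ?thesis
    using hyp_count_outside_unit_interval[of R 0] R(1) sgn_hyp_pderiv_at_0 by (simp only:) simp
qed

lemma hyp_count_above_1:
  "2 * (real (card {x. 1 < x \<and> poly F x = 0}) + real (card {x. 1 < x \<and> poly F' x = 0}))
     = 1 + sgn (c - b + real n)"
proof -
  obtain R0 where R0: "\<And>x. x \<ge> R0 \<Longrightarrow> poly F x * poly F' x > 0"
    using eventually_poly_mult_pderiv_pos[OF degree_F_pos] by (auto simp: F'_def)
  define R where "R = max R0 2"
  have R: "R > 1" "\<And>x. x \<ge> R \<Longrightarrow> poly F x * poly F' x > 0" using R0 by (auto simp: R_def)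
  have "x < R" if "poly F x = 0 \<or> poly F' x = 0" for x
    using R(2)[of x] that by force
  then have "{x. 1 < x \<and> poly F x = 0} = {x. 1 < x \<and> x < R \<and> poly F x = 0}"
    "{x. 1 < x \<and> poly F' x = 0} = {x. 1 < x \<and> x < R \<and> poly F' x = 0}" by auto
  moreover have "poly F 1 * poly F' 1 \<noteq> 0" by (rule hyp_pderiv_nonzero_at_1)
  moreover have "poly F R * poly F' R > 0" using R(2) by simp
  then have "poly F R * poly F' R \<noteq> 0" "sgn (poly F R * poly F' R) = 1" by auto
  ultimately show ?thesis
    using hyp_count_outside_unit_interval[of 1 R] R(1) sgn_hyp_pderiv_at_1 by (simp only:) simp
qed

end

section \<open>Real zeros\<close>

text \<open>
  The sign of the Pochhammer symbol \<open>(t)\<^sub>n\<close> is \<open>-1\<close> to this power if none of its factors vanishes.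
  The two recursions below, at the last and at the first term, match the two ways in which
  differentiation acts on the parameters \<open>c - b\<close> and \<open>c\<close>.
\<close>
definition negative_terms :: "nat \<Rightarrow> real \<Rightarrow> nat" where
  "negative_terms n t = (\<Sum>i<n. of_bool (t + real i < 0))"

lemma negative_terms_Suc: "negative_terms (Suc n) t = negative_terms n t + of_bool (t + real n < 0)"
  by (simp add: negative_terms_def)

lemma negative_terms_Suc_shift: "negative_terms (Suc n) t = of_bool (t < 0) + negative_terms n (t + 1)"
  by (simp add: negative_terms_def sum.lessThan_Suc_shift algebra_simps del: sum.lessThan_Suc)

lemma negative_terms_pos: "t > 0 \<Longrightarrow> negative_terms n t = 0"
  by (simp add: negative_terms_def)

lemma negative_terms_all: "t + real n < 0 \<Longrightarrow> negative_terms (Suc n) t = Suc n"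
proof -
  assume t: "t + real n < 0"
  have "negative_terms (Suc n) t = (\<Sum>i<Suc n. 1)"
    unfolding negative_terms_def using t by (intro sum.cong) auto
  then show ?thesis by simp
qed

lemma negative_terms_eq:
  assumes "m \<le> n" "- real m < t" "t < 1 - real m"
  shows "negative_terms n t = m"
proof -
  have "negative_terms n t = card {i. i < n \<and> t + real i < 0}"
    unfolding negative_terms_def by (simp add: sum.If_cases of_bool_def lessThan_def Collect_conj_eq)
  also have "{i. i < n \<and> t + real i < 0} = {..<m}"
    using assms by (auto simp: not_less intro: ccontr)
  finally show ?thesis by simp
qed

text \<open>
  Induction along \<open>(n + 1, b, c) \<rightarrow> (n, b + 1, c + 1)\<close>. On \<open>(0,1)\<close> the number of zeros changes by
  \<open>[c - b + n < 0] - [c < 0]\<close>, the change of the difference of the two counts of negative terms. On a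
  half-line zeros and critical points together are either absent or a single point. In the latter case
  the parity flips, as the respective count of negative (or non-negative) terms grows by one.
  In the former that count is \<open>0\<close>, because the terms of a progression increase.
\<close>
theorem hyp_real_zero_counts:
  fixes b c :: real
  assumes "b > 0" "\<forall>i<n. c + real i \<noteq> 0" "\<forall>i<n. c - b + real i \<noteq> 0"
  shows "card {x. 0 < x \<and> x < 1 \<and> poly (hyp n b c) x = 0} + negative_terms n c = negative_terms n (c - b)"
    and "card {x. x < 0 \<and> poly (hyp n b c) x = 0} = of_bool (odd (negative_terms n c))"
    and "card {x. 1 < x \<and> poly (hyp n b c) x = 0} = of_bool (odd (n + negative_terms n (c - b)))"
  using assms
proof (induction n arbitrary: b c)
  case 0
  { case 1 show ?case by (simp add: hyp_0 negative_terms_def)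
  next case 2 show ?case by (simp add: hyp_0 negative_terms_def)
  next case 3 show ?case by (simp add: hyp_0 negative_terms_def) }
next
  case (Suc n)
  have IH: "card {x. 0 < x \<and> x < 1 \<and> poly (hyp n (b + 1) (c + 1)) x = 0} + negative_terms n (c + 1)
        = negative_terms n (c - b)"
      "card {x. x < 0 \<and> poly (hyp n (b + 1) (c + 1)) x = 0} = of_bool (odd (negative_terms n (c + 1)))"
      "card {x. 1 < x \<and> poly (hyp n (b + 1) (c + 1)) x = 0} = of_bool (odd (n + negative_terms n (c - b)))"
    if "b > 0" "\<forall>i<Suc n. c + real i \<noteq> 0" "\<forall>i<Suc n. c - b + real i \<noteq> 0" for b c
    using Suc.IH[of "b + 1" "c + 1"] shift_nonzero[OF that(2)] that(1,3) by auto
  have nz: "c \<noteq> 0" "c - b + real n \<noteq> 0" 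
    if "\<forall>i<Suc n. c + real i \<noteq> 0" "\<forall>i<Suc n. c - b + real i \<noteq> 0" for b c :: real
    using that by fastforce+
  { case 1
    show ?case
      using hyp_count_unit_interval[OF 1] IH(1)[OF 1] nz[OF 1(2,3)]
      unfolding hyp_critical_point_iff[OF 1] negative_terms_Suc[of n "c - b"] negative_terms_Suc_shift[of n c]
      by (simp add: sgn_if of_bool_def split: if_splits)
  next
    case 2
    show ?case
    proof (cases "c < 0")
      case True
      then show ?thesis
        using hyp_count_negative[OF 2] IH(2)[OF 2]
        unfolding hyp_critical_point_iff[OF 2] negative_terms_Suc_shift[of n c]
        by (simp add: of_bool_def split: if_splits)
    next
      case False
      then show ?thesis
        using hyp_count_negative[OF 2] nz(1)[OF 2(2,3)] by (simp add: negative_terms_pos)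
    qed
  next
    case 3
    show ?case
    proof (cases "c - b + real n > 0")
      case True
      then show ?thesis
        using hyp_count_above_1[OF 3] IH(3)[OF 3]
        unfolding hyp_critical_point_iff[OF 3] negative_terms_Suc[of n "c - b"]
        by (simp add: of_bool_def split: if_splits)
    next
      case False
      then have neg: "c - b + real n < 0" using nz(2)[OF 3(2,3)] by simp
      then show ?thesis
        using hyp_count_above_1[OF 3] negative_terms_all[OF neg] by simp
    qed }
qed

section \<open>Complex zeros with multiplicity\<close>

lemma num_zeros_simple:
  assumes "p \<noteq> 0" "\<And>z. z \<in> S \<Longrightarrow> poly p z = 0 \<Longrightarrow> poly (pderiv p) z \<noteq> 0"
  shows "num_zeros p S = card {z \<in> S. poly p z = 0}"
proof -
  have "order z p = 1" if "z \<in> S" "poly p z = 0" for z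
    using order_pderiv[OF assms(1) that(2)] assms(2)[OF that] by (simp add: order_0I)
  then have "(\<Sum>z | z \<in> S \<and> poly p z = 0. order z p) = card {z \<in> S. poly p z = 0}"
    by simp
  then show ?thesis
    using assms(1) by (simp add: num_zeros_def size_multiset_overloaded_eq conj_commute)
qed

lemma num_zeros_Un:
  "S \<inter> T = {} \<Longrightarrow> num_zeros p (S \<union> T) = num_zeros p S + num_zeros p T"
  unfolding num_zeros_def size_union[symmetric]
  by (rule arg_cong[where f = size]) (auto simp: multiset_eq_iff)

lemma hypergeo_poly_eq_hyp:
  "hypergeo_poly n b c = hyp n (complex_of_real b) (complex_of_real c)"
proof (rule poly_eqI)
  fix k
  have "{..n} = insert 0 {1..n}" by auto
  then show "coeff (hypergeo_poly n b c) k = coeff (hyp n (complex_of_real b) (complex_of_real c)) k"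
    by (simp add: hypergeo_poly_def hyp_def pochhammer_of_real[symmetric] monom_eq_1 
        del: pochhammer_of_real)
qed

lemma poly_hyp_of_real:
  "poly (hyp n (complex_of_real b) (complex_of_real c)) (complex_of_real x)
     = complex_of_real (poly (hyp n b c) x)"
  by (simp add: hyp_def poly_sum poly_monom pochhammer_of_real[symmetric])

lemma num_zeros_hypergeo_poly_real:
  assumes "b > 0" and c: "\<forall>i<n. c + real i \<noteq> 0" and cb: "\<forall>i<n. c - b + real i \<noteq> 0"
  shows "num_zeros (hypergeo_poly n b c) (complex_of_real ` A)
    = card {x \<in> A. poly (hyp n b c) x = 0}"
proof -
  have "poly (hyp n b c) 1 \<noteq> 0" by (rule poly_hyp_1_nonzero[OF c cb])
  then have 01: "z \<noteq> 0 \<and> z \<noteq> 1" 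
    if "poly (hypergeo_poly n b c) z = 0" for z
    using that poly_hyp_of_real[of n b c 0] poly_hyp_of_real[of n b c 1] poly_hyp_0[of n b c]
    by (auto simp: hypergeo_poly_eq_hyp)
  have "complex_of_real b + of_nat i \<noteq> 0" for i
    using assms(1) by (metis add_pos_nonneg less_irrefl of_nat_0_le_iff of_real_add 
        of_real_eq_0_iff of_real_of_nat_eq)
  moreover have "\<forall>i<n. complex_of_real c + of_nat i \<noteq> 0"
    using c by (metis of_real_add of_real_eq_0_iff of_real_of_nat_eq)
  ultimately have "num_zeros (hypergeo_poly n b c) (complex_of_real ` A)
      = card {z \<in> complex_of_real ` A. poly (hypergeo_poly n b c) z = 0}"
    using 01 unfolding hypergeo_poly_eq_hyp
    by (intro num_zeros_simple hyp_nonzero hyp_simple_zeros) auto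
  also have "{z \<in> complex_of_real ` A. poly (hypergeo_poly n b c) z = 0} =
      complex_of_real ` {x \<in> A. poly (hyp n b c) x = 0}"
    by (auto simp: hypergeo_poly_eq_hyp poly_hyp_of_real)
  finally show ?thesis by (simp add: card_image inj_on_def)
qed

text \<open>
  The count of non-real zeros is what remains of the degree. It is stated without subtraction, so that
  no truncation of natural numbers can occur; likewise \<open>n + j\<close> stands for \<open>n - j\<close> in parities.
\<close>
theorem num_zeros_hypergeo_poly:
  assumes b: "b > 0" and c: "\<forall>i<n. c + real i \<noteq> 0" and cb: "\<forall>i<n. c - b + real i \<noteq> 0"
  defines "k \<equiv> negative_terms n c" and "j \<equiv> negative_terms n (c - b)"
    and "p \<equiv> hypergeo_poly n b c"
  shows "num_zeros p UNIV = n"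
    and "num_zeros p (complex_of_real ` {0<..<1}) + k = j"
    and "num_zeros p (complex_of_real ` {..<0}) = of_bool (odd k)"
    and "num_zeros p (complex_of_real ` {1<..}) = of_bool (odd (n + j))"
    and "num_zeros p (- \<real>) + j + of_bool (odd k) + of_bool (odd (n + j)) = n + k"
proof -
  note real_zeros = num_zeros_hypergeo_poly_real[OF b c cb, folded p_def]
  have "map_poly complex_of_real (hyp n b c) = p"
    by (intro poly_eqI) (simp add: p_def hypergeo_poly_eq_hyp coeff_map_poly coeff_hyp 
        pochhammer_of_real[symmetric] )
  then have "degree p = n"
    using degree_map_poly[of complex_of_real "hyp n b c"] degree_hyp[OF b c] by simp
  then show total: "num_zeros p UNIV = n"
    by (simp add: num_zeros_def size_proots_complex)
  show unit: "num_zeros p (complex_of_real ` {0<..<1}) + k = j"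
    using hyp_real_zero_counts(1)[OF b c cb] by (simp add: real_zeros k_def j_def conj_assoc)
  show neg: "num_zeros p (complex_of_real ` {..<0}) = of_bool (odd k)"
    using hyp_real_zero_counts(2)[OF b c cb] by (simp add: real_zeros k_def)
  show above: "num_zeros p (complex_of_real ` {1<..}) = of_bool (odd (n + j))"
    using hyp_real_zero_counts(3)[OF b c cb] by (simp add: real_zeros j_def)
  have "poly (hyp n b c) 0 \<noteq> 0" "poly (hyp n b c) 1 \<noteq> 0"
    using poly_hyp_1_nonzero[OF c cb] by (simp_all add: poly_hyp_0)
  then have none: "num_zeros p (complex_of_real ` {0, 1}) = 0"
    unfolding real_zeros by (auto simp: card_eq_0_iff)
  have Reals_split: "(\<real> :: complex set) = complex_of_real ` {..<0} \<union> complex_of_real ` {0<..<1}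
      \<union> complex_of_real ` {1<..} \<union> complex_of_real ` {0, 1}"
    unfolding Reals_def image_Un[symmetric] by (rule arg_cong[where f = "image complex_of_real"]) auto
  have "num_zeros p \<real> = num_zeros p (complex_of_real ` {..<0})
      + num_zeros p (complex_of_real ` {0<..<1}) + num_zeros p (complex_of_real ` {1<..})"
    unfolding Reals_split by (subst num_zeros_Un, force)+ (simp only: none add_0_right)
  moreover have "num_zeros p UNIV = num_zeros p (- \<real>) + num_zeros p \<real>"
    by (subst num_zeros_Un[symmetric]) (auto simp: Un_commute)
  ultimately show "num_zeros p (- \<real>) + j + of_bool (odd k) + of_bool (odd (n + j)) = n + k"
    using total unit neg above by simp
qed

theorem theorem3p3:
  fixes n :: nat and b c :: real
  assumes "n > 0"
    and "\<forall>i<n. c \<noteq> - real i"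
    and "c < 0" and "b > 0" and "c - b > 1 - real n"
  shows
    "(1 - real n < c - b \<and> c - b < 0) \<and> (0 < b \<and> b < real n - 1) \<and> (1 - real n < c \<and> c < 0) \<and>
    (\<forall>k\<in>{1..n-1}. \<forall>j\<in>{1..n-1}.
       - real k < c \<and> c < - real k + 1 \<and> - real j < c - b \<and> c - b < - real j + 1 \<longrightarrow>
         k \<le> j \<and>
         num_zeros (hypergeo_poly n b c) UNIV = n \<and>
         num_zeros (hypergeo_poly n b c) (complex_of_real ` {0<..<1}) = j - k \<and>
         (even (n - j) \<and> even k \<longrightarrow>
            num_zeros (hypergeo_poly n b c) (- \<real>) = n - j + k) \<and>
         (odd (n - j) \<and> even k \<longrightarrow>
            num_zeros (hypergeo_poly n b c) (- \<real>) = n - j + k - 1 \<and>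
            num_zeros (hypergeo_poly n b c) (complex_of_real ` {1<..}) = 1) \<and>
         (even (n - j) \<and> odd k \<longrightarrow>
            num_zeros (hypergeo_poly n b c) (- \<real>) = n - j + k - 1 \<and>
            num_zeros (hypergeo_poly n b c) (complex_of_real ` {..<0}) = 1) \<and>
         (odd (n - j) \<and> odd k \<longrightarrow>
            num_zeros (hypergeo_poly n b c) (- \<real>) = n - j + k - 2 \<and>
            num_zeros (hypergeo_poly n b c) (complex_of_real ` {..<0}) = 1 \<and>
            num_zeros (hypergeo_poly n b c) (complex_of_real ` {1<..}) = 1))"
proof -
  have part_ii: "k \<le> j \<and>
         num_zeros (hypergeo_poly n b c) UNIV = n \<and>
         num_zeros (hypergeo_poly n b c) (complex_of_real ` {0<..<1}) = j - k \<and>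
         (even (n - j) \<and> even k \<longrightarrow>
            num_zeros (hypergeo_poly n b c) (- \<real>) = n - j + k) \<and>
         (odd (n - j) \<and> even k \<longrightarrow>
            num_zeros (hypergeo_poly n b c) (- \<real>) = n - j + k - 1 \<and>
            num_zeros (hypergeo_poly n b c) (complex_of_real ` {1<..}) = 1) \<and>
         (even (n - j) \<and> odd k \<longrightarrow>
            num_zeros (hypergeo_poly n b c) (- \<real>) = n - j + k - 1 \<and>
            num_zeros (hypergeo_poly n b c) (complex_of_real ` {..<0}) = 1) \<and>
         (odd (n - j) \<and> odd k \<longrightarrow>
            num_zeros (hypergeo_poly n b c) (- \<real>) = n - j + k - 2 \<and>
            num_zeros (hypergeo_poly n b c) (complex_of_real ` {..<0}) = 1 \<and>
            num_zeros (hypergeo_poly n b c) (complex_of_real ` {1<..}) = 1)"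
    if kj: "k \<in> {1..n-1}" "j \<in> {1..n-1}"
      and k: "- real k < c" "c < - real k + 1"
      and j: "- real j < c - b" "c - b < - real j + 1" for k j
  proof -
    have c: "\<forall>i<n. c + real i \<noteq> 0" using assms(2) by (auto simp: eq_neg_iff_add_eq_0)
    \<comment> \<open>\<open>c - b\<close> lies strictly between two consecutive integers, so it is not an integer.\<close>
    have cb: "\<forall>i<n. c - b + real i \<noteq> 0"
    proof (intro allI impI notI)
      fix i assume "c - b + real i = 0"
      then have "real i < real j" "real j < real (Suc i)" using j by auto
      then show False by simp
    qed
    have "negative_terms n c = k" "negative_terms n (c - b) = j"
      using kj k j by (auto intro!: negative_terms_eq)
    note counts = num_zeros_hypergeo_poly[OF assms(4) c cb, unfolded this]
    have "k \<le> j" "j \<le> n" using counts(2) kj by auto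
    moreover from \<open>j \<le> n\<close> have "odd (n + j) = odd (n - j)" by auto
    ultimately show ?thesis using counts by auto
  qed
  show ?thesis using part_ii assms by auto
qed

end
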